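(* Let $(X,\Sigma,\mu)$ be a $\sigma$-finite measure space, let $u:X\to\mathbb{C}$ be $\Sigma$-measurable, and let $M_u$ be the multiplication operator in $L^2(\mu)$. Suppose $\mathcal{D}((M_u)^2)$ is dense in $L^2(\mu)$ and let $k\ge1$ be fixed. Then: (i) $M_u$ is $k$-hyperexpansive if and only if $\triangle_{u,i}(x)\le0$ for $\mu$-a.e. $x$, for every $i=1,\dots,k$, where $\triangle_{u,i}(x)=\sum_{0\le j\le i}(-1)^j\binom{i}{j}|u(x)|^{2j}$. (ii) $M_u$ is completely hyperexpansive if and only if, for $\mu$-almost every $x\in X$, the sequence $\{|u(x)|^{2i}\}_{i=0}^\infty$ is completely alternating.
   Context: An operator $T$ in a Hilbert space $\mathcal{H}$ is a linear map $T:\mathcal{D}(T)\to\mathcal{H}$ on a linear subspace $\mathcal{D}(T)\subseteq\mathcal{H}$; powers $T^n$ have their natural domains. $M_u$ in $L^2(\mu)$ has domain $\{f\in L^2(\mu): uf\in L^2(\mu)\}$ and acts by $M_uf=uf$. For an operator $T$ and $n\ge1$, $\Theta_{T,n}(f)=\sum_{0\le i\le n}(-1)^i\binom{n}{i}\|T^i f\|^2$ for $f\in\mathcal{D}(T^n)$. $T$ is $k$-hyperexpansive if $\Theta_{T,n}(f)\le0$ for all $f\in\mathcal{D}(T^n)$ and $n=1,\dots,k$; completely hyperexpansive if $\Theta_{T,n}(f)\le 0$ for all $f\in\mathcal{D}(T^n)$ and all $n\ge1$. A real sequence $\{\varphi(i)\}_{i=0}^\infty$ is completely alternating if $\sum_{0\le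 i\le n}(-1)^i\binom{n}{i}\varphi(m+i)\le0$ for all $m\ge0$ and $n\ge1$. *)

theory Defs
  imports "HOL-Analysis.Analysis"
begin

section \<open>Operators in a Hilbert space given by a carrier set\<close>

text \<open>The space \<open>L\<^sup>2(\<mu>)\<close> depends on the measure, hence is a set rather than a type; vector
  spaces with an inner product are therefore given by a record with an explicit carrier.\<close>

record 'h inner_space =
  vectors :: "'h set"
  hadd :: "'h \<Rightarrow> 'h \<Rightarrow> 'h"
  hscale :: "complex \<Rightarrow> 'h \<Rightarrow> 'h"
  ip :: "'h \<Rightarrow> 'h \<Rightarrow> complex"

definition hnorm :: "'h inner_space \<Rightarrow> 'h \<Rightarrow> real" where
  "hnorm H f = sqrt (Re (ip H f f))"

definition hdist :: "'h inner_space \<Rightarrow> 'h \<Rightarrow> 'h \<Rightarrow> real" where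
  "hdist H f g = hnorm H (hadd H f (hscale H (-1) g))"

definition dense_in :: "'h inner_space \<Rightarrow> 'h set \<Rightarrow> bool" where
  "dense_in H D \<longleftrightarrow> D \<subseteq> vectors H \<and> (\<forall>f \<in> vectors H. \<forall>e>0. \<exists>g \<in> D. hdist H f g < e)"

text \<open>An operator is a partial map \<open>T\<close>; its domain is \<^term>\<open>dom T\<close>.\<close>

definition operator_in :: "'h inner_space \<Rightarrow> ('h \<rightharpoonup> 'h) \<Rightarrow> bool" where
  "operator_in H T \<longleftrightarrow>
     dom T \<noteq> {} \<and> dom T \<subseteq> vectors H \<and> ran T \<subseteq> vectors H \<and>
     (\<forall>f \<in> dom T. \<forall>g \<in> dom T. T (hadd H f g) = Some (hadd H (the (T f)) (the (T g)))) \<and>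
     (\<forall>c. \<forall>f \<in> dom T. T (hscale H c f) = Some (hscale H c (the (T f))))"

text \<open>Since \<open>\<circ>\<^sub>m\<close> is composition of partial maps, the powers have their natural domains:
  \<open>f \<in> dom T\<^bsup>n+1\<^esup>\<close> iff \<open>f \<in> dom T\<^bsup>n\<^esup>\<close> and \<open>T\<^bsup>n\<^esup> f \<in> dom T\<close>.\<close>

primrec op_power :: "'h inner_space \<Rightarrow> ('h \<rightharpoonup> 'h) \<Rightarrow> nat \<Rightarrow> ('h \<rightharpoonup> 'h)" where
  "op_power H T 0 = Some |` vectors H"
| "op_power H T (Suc n) = T \<circ>\<^sub>m op_power H T n"

definition Theta :: "'h inner_space \<Rightarrow> ('h \<rightharpoonup> 'h) \<Rightarrow> nat \<Rightarrow> 'h \<Rightarrow> real" where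
  "Theta H T n f =
     (\<Sum>i\<le>n. (-1) ^ i * real (n choose i) * (hnorm H (the (op_power H T i f)))\<^sup>2)"

definition k_hyperexpansive :: "'h inner_space \<Rightarrow> nat \<Rightarrow> ('h \<rightharpoonup> 'h) \<Rightarrow> bool" where
  "k_hyperexpansive H k T \<longleftrightarrow>
     (\<forall>n \<in> {1..k}. \<forall>f \<in> dom (op_power H T n). Theta H T n f \<le> 0)"

definition completely_hyperexpansive :: "'h inner_space \<Rightarrow> ('h \<rightharpoonup> 'h) \<Rightarrow> bool" where
  "completely_hyperexpansive H T \<longleftrightarrow>
     (\<forall>n\<ge>1. \<forall>f \<in> dom (op_power H T n). Theta H T n f \<le> 0)"

definition completely_alternating :: "(nat \<Rightarrow> real) \<Rightarrow> bool" where
  "completely_alternating \<phi> \<longleftrightarrow>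
     (\<forall>m. \<forall>n\<ge>1. (\<Sum>i\<le>n. (-1) ^ i * real (n choose i) * \<phi> (m + i)) \<le> 0)"


section \<open>The space \<open>L\<^sup>2(\<mu>)\<close> and multiplication operators\<close>

definition sq_integrable :: "'a measure \<Rightarrow> ('a \<Rightarrow> complex) set" where
  "sq_integrable M = {f \<in> borel_measurable M. integrable M (\<lambda>x. (cmod (f x))\<^sup>2)}"

definition ae_rel :: "'a measure \<Rightarrow> (('a \<Rightarrow> complex) \<times> ('a \<Rightarrow> complex)) set" where
  "ae_rel M = {(f, g). f \<in> sq_integrable M \<and> g \<in> sq_integrable M \<and> (AE x in M. f x = g x)}"

text \<open>Elements of \<open>L\<^sup>2(\<mu>)\<close> are equivalence classes. The unions below lift functions that
  respect \<^const>\<open>ae_rel\<close>: all the sets united are the same class.\<close>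

definition L2 :: "'a measure \<Rightarrow> ('a \<Rightarrow> complex) set inner_space" where
  "L2 M = \<lparr>
     vectors = sq_integrable M // ae_rel M,
     hadd = (\<lambda>F G. \<Union>f\<in>F. \<Union>g\<in>G. ae_rel M `` {\<lambda>x. f x + g x}),
     hscale = (\<lambda>c F. \<Union>f\<in>F. ae_rel M `` {\<lambda>x. c * f x}),
     ip = (\<lambda>F G. \<integral>x. (SOME f. f \<in> F) x * cnj ((SOME g. g \<in> G) x) \<partial>M) \<rparr>"

definition mult_op :: "'a measure \<Rightarrow> ('a \<Rightarrow> complex) \<Rightarrow>
    (('a \<Rightarrow> complex) set \<rightharpoonup> ('a \<Rightarrow> complex) set)" where
  "mult_op M u F =
     (if F \<in> vectors (L2 M) \<and> (\<forall>f\<in>F. (\<lambda>x. u x * f x) \<in> sq_integrable M)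
      then Some (\<Union>f\<in>F. ae_rel M `` {\<lambda>x. u x * f x}) else None)"

definition triangle_fun :: "('a \<Rightarrow> complex) \<Rightarrow> nat \<Rightarrow> 'a \<Rightarrow> real" where
  "triangle_fun u i x = (\<Sum>j\<le>i. (-1) ^ j * real (i choose j) * (cmod (u x)) ^ (2 * j))"


section \<open>Independence of representatives\<close>

lemma sq_integrable_add:
  assumes "f \<in> sq_integrable M" "g \<in> sq_integrable M"
  shows "(\<lambda>x. f x + g x) \<in> sq_integrable M"
proof -
  have [measurable]: "f \<in> borel_measurable M" "g \<in> borel_measurable M"
    using assms by (auto simp: sq_integrable_def)
  have "integrable M (\<lambda>x. 2 * (cmod (f x))\<^sup>2 + 2 * (cmod (g x))\<^sup>2)"
    using assms by (auto simp: sq_integrable_def)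
  moreover have "(cmod (f x + g x))\<^sup>2 \<le> 2 * (cmod (f x))\<^sup>2 + 2 * (cmod (g x))\<^sup>2" for x
  proof -
    have "(cmod (f x + g x))\<^sup>2 \<le> (cmod (f x) + cmod (g x))\<^sup>2"
      by (intro power_mono norm_triangle_ineq) auto
    also have "\<dots> \<le> 2 * (cmod (f x))\<^sup>2 + 2 * (cmod (g x))\<^sup>2"
      using sum_squares_bound[of "cmod (f x)" "cmod (g x)"] by (simp add: power2_sum)
    finally show ?thesis .
  qed
  ultimately have "integrable M (\<lambda>x. (cmod (f x + g x))\<^sup>2)"
    by (elim Bochner_Integration.integrable_bound) auto
  then show ?thesis by (simp add: sq_integrable_def)
qed

lemma sq_integrable_scale:
  "f \<in> sq_integrable M \<Longrightarrow> (\<lambda>x. c * f x) \<in> sq_integrable M"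
  by (auto simp: sq_integrable_def norm_mult power_mult_distrib)

lemma equiv_ae_rel: "equiv (sq_integrable M) (ae_rel M)"
proof (rule equivI)
  show "ae_rel M \<subseteq> sq_integrable M \<times> sq_integrable M" by (auto simp: ae_rel_def)
  show "refl_on (sq_integrable M) (ae_rel M)" by (auto simp: refl_on_def ae_rel_def)
  show "sym (ae_rel M)" by (simp add: sym_def ae_rel_def eq_commute)
  show "trans (ae_rel M)"
  proof (rule transI)
    fix f g h assume *: "(f, g) \<in> ae_rel M" "(g, h) \<in> ae_rel M"
    then have "AE x in M. f x = g x" "AE x in M. g x = h x" by (simp_all add: ae_rel_def)
    then have "AE x in M. f x = h x" by eventually_elim simp
    with * show "(f, h) \<in> ae_rel M" by (simp add: ae_rel_def)
  qed
qed

lemma vectors_L2I: "f \<in> sq_integrable M \<Longrightarrow> ae_rel M `` {f} \<in> vectors (L2 M)"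
  by (simp add: L2_def quotientI)

lemma vectors_L2E:
  assumes "F \<in> vectors (L2 M)"
  obtains f where "f \<in> sq_integrable M" "F = ae_rel M `` {f}"
  using assms by (auto simp: L2_def elim: quotientE)

lemma add_L2:
  assumes "f \<in> sq_integrable M" "g \<in> sq_integrable M"
  shows "hadd (L2 M) (ae_rel M `` {f}) (ae_rel M `` {g}) = ae_rel M `` {\<lambda>x. f x + g x}"
proof -
  have "congruent2 (ae_rel M) (ae_rel M) (\<lambda>f g. ae_rel M `` {\<lambda>x. f x + g x})"
  proof (rule congruent2I')
    fix f f' g g' assume *: "(f, f') \<in> ae_rel M" "(g, g') \<in> ae_rel M"
    then have "AE x in M. f x = f' x" "AE x in M. g x = g' x" by (simp_all add: ae_rel_def)
    then have "AE x in M. f x + g x = f' x + g' x" by eventually_elim simp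
    with * show "ae_rel M `` {\<lambda>x. f x + g x} = ae_rel M `` {\<lambda>x. f' x + g' x}"
      by (intro equiv_class_eq[OF equiv_ae_rel])
         (auto simp: ae_rel_def intro: sq_integrable_add)
  qed
  from UN_equiv_class2[OF equiv_ae_rel equiv_ae_rel this assms] show ?thesis
    by (simp add: L2_def)
qed

lemma scale_L2:
  assumes "f \<in> sq_integrable M"
  shows "hscale (L2 M) c (ae_rel M `` {f}) = ae_rel M `` {\<lambda>x. c * f x}"
proof -
  have "congruent (ae_rel M) (\<lambda>f. ae_rel M `` {\<lambda>x. c * f x})"
  proof (rule congruentI, rule equiv_class_eq[OF equiv_ae_rel])
    fix f g assume *: "(f, g) \<in> ae_rel M"
    then have "AE x in M. f x = g x" by (simp add: ae_rel_def)
    then have "AE x in M. c * f x = c * g x" by eventually_elim simp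
    with * show "(\<lambda>x. c * f x, \<lambda>x. c * g x) \<in> ae_rel M"
      by (simp add: ae_rel_def sq_integrable_scale)
  qed
  from UN_equiv_class[OF equiv_ae_rel this assms] show ?thesis
    by (simp add: L2_def)
qed

lemma ip_L2:
  assumes f: "f \<in> sq_integrable M" and g: "g \<in> sq_integrable M"
  shows "ip (L2 M) (ae_rel M `` {f}) (ae_rel M `` {g}) = (\<integral>x. f x * cnj (g x) \<partial>M)"
proof -
  define f' where "f' = (SOME h. h \<in> ae_rel M `` {f})"
  define g' where "g' = (SOME h. h \<in> ae_rel M `` {g})"
  have "f' \<in> ae_rel M `` {f}" "g' \<in> ae_rel M `` {g}"
    unfolding f'_def g'_def
    using someI[of "\<lambda>h. h \<in> ae_rel M `` {f}", OF equiv_class_self[OF equiv_ae_rel f]]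
      someI[of "\<lambda>h. h \<in> ae_rel M `` {g}", OF equiv_class_self[OF equiv_ae_rel g]]
    by simp_all
  then have *: "(f, f') \<in> ae_rel M" "(g, g') \<in> ae_rel M" by auto
  then have [measurable]: "f \<in> borel_measurable M" "g \<in> borel_measurable M"
     "f' \<in> borel_measurable M" "g' \<in> borel_measurable M"
    by (auto simp: ae_rel_def sq_integrable_def)
  have [measurable]: "cnj \<in> borel_measurable borel"
    by (intro borel_measurable_continuous_onI continuous_intros)
  have "AE x in M. f x = f' x" "AE x in M. g x = g' x"
    using * by (auto simp: ae_rel_def)
  then have "AE x in M. f' x * cnj (g' x) = f x * cnj (g x)" by eventually_elim simp
  then have "(\<integral>x. f' x * cnj (g' x) \<partial>M) = (\<integral>x. f x * cnj (g x) \<partial>M)"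
    by (intro integral_cong_AE) measurable
  then show ?thesis by (simp add: L2_def f'_def g'_def)
qed

lemma hnorm_L2:
  assumes "f \<in> sq_integrable M"
  shows "hnorm (L2 M) (ae_rel M `` {f}) = sqrt (\<integral>x. (cmod (f x))\<^sup>2 \<partial>M)"
proof -
  have "(\<integral>x. f x * cnj (f x) \<partial>M) = complex_of_real (\<integral>x. (cmod (f x))\<^sup>2 \<partial>M)"
    by (simp add: complex_norm_square[symmetric] flip: integral_complex_of_real of_real_power)
  then show ?thesis by (simp add: hnorm_def ip_L2[OF assms assms])
qed

lemma mult_op_class:
  assumes u: "u \<in> borel_measurable M" and f: "f \<in> sq_integrable M"
  shows "mult_op M u (ae_rel M `` {f}) =
    (if (\<lambda>x. u x * f x) \<in> sq_integrable M then Some (ae_rel M `` {\<lambda>x. u x * f x}) else None)"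
proof -
  note [measurable] = u
  have cong: "(\<lambda>x. u x * h x) \<in> sq_integrable M \<and>
      ae_rel M `` {\<lambda>x. u x * h x} = ae_rel M `` {\<lambda>x. u x * f x}"
    if uf: "(\<lambda>x. u x * f x) \<in> sq_integrable M" and h: "h \<in> ae_rel M `` {f}" for h
  proof -
    have [measurable]: "f \<in> borel_measurable M" "h \<in> borel_measurable M"
      using f h by (auto simp: ae_rel_def sq_integrable_def)
    have "AE x in M. f x = h x" using h by (simp add: ae_rel_def)
    then have ae: "AE x in M. u x * f x = u x * h x" by eventually_elim simp
    have "integrable M (\<lambda>x. (cmod (u x * h x))\<^sup>2)"
    proof (rule iffD1[OF integrable_cong_AE])
      show "AE x in M. (cmod (u x * f x))\<^sup>2 = (cmod (u x * h x))\<^sup>2"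
        using ae by eventually_elim (rule arg_cong)
      show "integrable M (\<lambda>x. (cmod (u x * f x))\<^sup>2)"
        using uf by (simp add: sq_integrable_def)
    qed measurable
    then have uh: "(\<lambda>x. u x * h x) \<in> sq_integrable M" by (simp add: sq_integrable_def)
    have "(\<lambda>x. u x * f x, \<lambda>x. u x * h x) \<in> ae_rel M"
      using uf uh ae by (simp add: ae_rel_def)
    then show ?thesis using uh equiv_class_eq[OF equiv_ae_rel] by metis
  qed
  have self: "f \<in> ae_rel M `` {f}" by (rule equiv_class_self[OF equiv_ae_rel f])
  show ?thesis
  proof (cases "(\<lambda>x. u x * f x) \<in> sq_integrable M")
    case True
    have "(\<Union>h \<in> ae_rel M `` {f}. ae_rel M `` {\<lambda>x. u x * h x}) = ae_rel M `` {\<lambda>x. u x * f x}"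
      using cong[OF True] self by blast
    then show ?thesis
      using True cong[OF True] vectors_L2I[OF f] by (simp add: mult_op_def)
  next
    case False
    then show ?thesis using self by (auto simp: mult_op_def)
  qed
qed

lemma dom_mult_opE:
  assumes u: "u \<in> borel_measurable M" and F: "F \<in> dom (mult_op M u)"
  obtains f where "f \<in> sq_integrable M" "(\<lambda>x. u x * f x) \<in> sq_integrable M"
    "F = ae_rel M `` {f}" "mult_op M u F = Some (ae_rel M `` {\<lambda>x. u x * f x})"
proof -
  have "F \<in> vectors (L2 M)" using F by (auto simp: mult_op_def split: if_splits)
  then obtain f where f: "f \<in> sq_integrable M" "F = ae_rel M `` {f}" by (rule vectors_L2E)
  then show ?thesis using that[of f] F mult_op_class[OF u f(1)] by (auto split: if_splits)
qed

lemma operator_in_mult_op: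
  assumes u: "u \<in> borel_measurable M"
  shows "operator_in (L2 M) (mult_op M u)"
  unfolding operator_in_def
proof (intro conjI ballI allI)
  have "(\<lambda>x. 0) \<in> sq_integrable M" by (simp add: sq_integrable_def)
  then have "ae_rel M `` {\<lambda>x. 0} \<in> dom (mult_op M u)"
    using mult_op_class[OF u, of "\<lambda>x. 0"] by auto
  then show "dom (mult_op M u) \<noteq> {}" by blast
  show "dom (mult_op M u) \<subseteq> vectors (L2 M)"
    by (auto simp: mult_op_def split: if_splits)
  show "ran (mult_op M u) \<subseteq> vectors (L2 M)"
  proof
    fix G assume "G \<in> ran (mult_op M u)"
    then obtain F where F: "mult_op M u F = Some G" by (auto simp: ran_def)
    then have "F \<in> dom (mult_op M u)" by auto
    from u this show "G \<in> vectors (L2 M)"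
      by (rule dom_mult_opE) (use F in \<open>auto intro: vectors_L2I\<close>)
  qed
next
  fix F G assume F: "F \<in> dom (mult_op M u)" and G: "G \<in> dom (mult_op M u)"
  from u F obtain f where f: "f \<in> sq_integrable M" "(\<lambda>x. u x * f x) \<in> sq_integrable M"
      "F = ae_rel M `` {f}" "mult_op M u F = Some (ae_rel M `` {\<lambda>x. u x * f x})"
    by (rule dom_mult_opE)
  from u G obtain g where g: "g \<in> sq_integrable M" "(\<lambda>x. u x * g x) \<in> sq_integrable M"
      "G = ae_rel M `` {g}" "mult_op M u G = Some (ae_rel M `` {\<lambda>x. u x * g x})"
    by (rule dom_mult_opE)
  show "mult_op M u (hadd (L2 M) F G) =
      Some (hadd (L2 M) (the (mult_op M u F)) (the (mult_op M u G)))"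
    using f(1,2) g(1,2) sq_integrable_add[OF f(1) g(1)] sq_integrable_add[OF f(2) g(2)]
    unfolding f(4) g(4) unfolding f(3) g(3)
    by (simp add: add_L2 mult_op_class[OF u] distrib_left)
next
  fix c F assume "F \<in> dom (mult_op M u)"
  with u obtain f where f: "f \<in> sq_integrable M" "(\<lambda>x. u x * f x) \<in> sq_integrable M"
      "F = ae_rel M `` {f}" "mult_op M u F = Some (ae_rel M `` {\<lambda>x. u x * f x})"
    by (rule dom_mult_opE)
  show "mult_op M u (hscale (L2 M) c F) = Some (hscale (L2 M) c (the (mult_op M u F)))"
    using f(1,2) sq_integrable_scale[OF f(1), of c] sq_integrable_scale[OF f(2), of c]
    unfolding f(4) unfolding f(3)
    by (simp add: scale_L2 mult_op_class[OF u] mult.left_commute)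
qed

end

theory Submission
  imports Defs
begin

text \<open>For \<open>f\<close> in the domain of the \<open>n\<close>-th power, \<open>Theta\<close> equals
  \<open>\<integral> triangle_fun u n x * |f x|\<^sup>2 d\<mu>\<close>, so a pointwise sign condition on \<open>triangle_fun u n\<close>
  gives the sign of \<open>Theta\<close>. Conversely, test with indicators of the finite-measure sets on which
  \<open>|u|\<close> is bounded and \<open>triangle_fun u n > 0\<close>; by \<open>\<sigma>\<close>-finiteness countably many of them cover
  the set where the sign condition fails. For the second claim,
  \<open>\<Sum>i\<le>n. (-1)\<^sup>i (n choose i) |u|\<^bsup>2(m+i)\<^esup> = |u|\<^bsup>2m\<^esup> triangle_fun u n\<close>.\<close>

text \<open>A composite of partial maps is defined only where every intermediate result is, so all
  exponents up to \<open>n\<close> occur in the condition. These are also the exponents in the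
  summands of \<open>Theta\<close>.\<close>

lemma op_power_mult_op:
  assumes u: "u \<in> borel_measurable M" and f: "f \<in> sq_integrable M"
  shows "op_power (L2 M) (mult_op M u) n (ae_rel M `` {f}) =
    (if \<forall>i\<le>n. (\<lambda>x. u x ^ i * f x) \<in> sq_integrable M
     then Some (ae_rel M `` {\<lambda>x. u x ^ n * f x}) else None)"
proof (induction n)
  case 0
  then show ?case using f vectors_L2I[OF f] by simp
next
  case (Suc n)
  show ?case
  proof (cases "\<forall>i\<le>n. (\<lambda>x. u x ^ i * f x) \<in> sq_integrable M")
    case True
    then have "(\<lambda>x. u x ^ n * f x) \<in> sq_integrable M" by simp
    from mult_op_class[OF u this] True Suc show ?thesis
      by (auto simp: map_comp_def le_Suc_eq mult.assoc)
  next
    case False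
    then show ?thesis using Suc by (auto simp: map_comp_def le_Suc_eq)
  qed
qed

lemma dom_op_power_mult_opE:
  assumes u: "u \<in> borel_measurable M" and F: "F \<in> dom (op_power (L2 M) (mult_op M u) n)"
  obtains f where "f \<in> sq_integrable M" "F = ae_rel M `` {f}"
    "\<And>i. i \<le> n \<Longrightarrow> (\<lambda>x. u x ^ i * f x) \<in> sq_integrable M"
proof -
  \<comment> \<open>Power 0 is the identity restricted to the carrier, and composing with
    \<open>mult_op M u\<close> can only shrink the domain.\<close>
  have "dom (op_power (L2 M) (mult_op M u) n) \<subseteq> vectors (L2 M)" for n
    by (induction n) (auto simp: map_comp_def restrict_map_def split: option.splits if_splits)
  then have "F \<in> vectors (L2 M)" using F by blast
  then obtain f where f: "f \<in> sq_integrable M" "F = ae_rel M `` {f}" by (rule vectors_L2E)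
  with F that[OF f] op_power_mult_op[OF u f(1), of n] show ?thesis
    by (auto split: if_splits)
qed

text \<open>Each \<open>\<parallel>T^i f\<parallel>^2\<close> is the integral of
  \<open>|u|^(2i) |f|^2\<close>; all of these are finite, so the alternating sum may be taken under
  the integral.\<close>

lemma Theta_mult_op:
  assumes u: "u \<in> borel_measurable M"
    and f: "\<And>i. i \<le> n \<Longrightarrow> (\<lambda>x. u x ^ i * f x) \<in> sq_integrable M"
  shows "integrable M (\<lambda>x. triangle_fun u n x * (cmod (f x))\<^sup>2)"
    and "Theta (L2 M) (mult_op M u) n (ae_rel M `` {f}) =
      (\<integral>x. triangle_fun u n x * (cmod (f x))\<^sup>2 \<partial>M)"
proof -
  have f0: "f \<in> sq_integrable M" using f[of 0] by simp
  have int: "integrable M (\<lambda>x. (cmod (u x ^ i * f x))\<^sup>2)" if "i \<le> n" for i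
    using f[OF that] by (simp add: sq_integrable_def)
  have eq: "triangle_fun u n x * (cmod (f x))\<^sup>2 =
      (\<Sum>i\<le>n. (-1) ^ i * real (n choose i) * (cmod (u x ^ i * f x))\<^sup>2)" for x
    by (simp add: triangle_fun_def sum_distrib_right norm_mult norm_power power_mult_distrib
        mult.assoc mult.commute[of _ 2] flip: power_mult)
  show "integrable M (\<lambda>x. triangle_fun u n x * (cmod (f x))\<^sup>2)"
    unfolding eq using int by auto
  have "(hnorm (L2 M) (the (op_power (L2 M) (mult_op M u) i (ae_rel M `` {f}))))\<^sup>2 =
      (\<integral>x. (cmod (u x ^ i * f x))\<^sup>2 \<partial>M)" if "i \<le> n" for i
    using f that by (simp add: op_power_mult_op[OF u f0] hnorm_L2)
  then have "Theta (L2 M) (mult_op M u) n (ae_rel M `` {f}) =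
      (\<Sum>i\<le>n. (-1) ^ i * real (n choose i) * (\<integral>x. (cmod (u x ^ i * f x))\<^sup>2 \<partial>M))"
    by (simp add: Theta_def)
  also have "\<dots> = (\<integral>x. triangle_fun u n x * (cmod (f x))\<^sup>2 \<partial>M)"
    unfolding eq using int by (simp add: Bochner_Integration.integral_sum)
  finally show "Theta (L2 M) (mult_op M u) n (ae_rel M `` {f}) =
      (\<integral>x. triangle_fun u n x * (cmod (f x))\<^sup>2 \<partial>M)" .
qed

lemma borel_measurable_triangle_fun [measurable]:
  "u \<in> borel_measurable M \<Longrightarrow> triangle_fun u n \<in> borel_measurable M"
  unfolding triangle_fun_def[abs_def] by measurable

text \<open>Supplies the test functions: the squared modulus is dominated by a constant on a set of
  finite measure.\<close>

lemma power_mult_indicator_sq_integrable: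
  fixes u :: "'a \<Rightarrow> complex"
  assumes [measurable]: "u \<in> borel_measurable M" "B \<in> sets M"
    and fin: "emeasure M B < \<infinity>" and bound: "\<And>x. x \<in> B \<Longrightarrow> cmod (u x) \<le> C"
  shows "(\<lambda>x. u x ^ i * indicator B x) \<in> sq_integrable M"
proof -
  have "integrable M (\<lambda>x. (cmod (u x ^ i * indicator B x))\<^sup>2)"
  proof (rule Bochner_Integration.integrable_bound)
    show "integrable M (\<lambda>x. (C ^ i)\<^sup>2 * indicator B x :: real)"
      using fin by (intro integrable_mult_right integrable_real_indicator) auto
    show "AE x in M. norm ((cmod (u x ^ i * indicator B x))\<^sup>2) \<le> norm ((C ^ i)\<^sup>2 * indicator B x :: real)"
      using bound by (intro AE_I2)
        (auto simp: indicator_def norm_mult norm_power intro!: power_mono)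
  qed measurable
  then show ?thesis by (simp add: sq_integrable_def)
qed

text \<open>Fixing a single \<open>n\<close> lets both equivalences of the theorem follow by
  quantifying over \<open>n\<close>.\<close>

lemma Theta_mult_op_nonpos_iff:
  assumes "sigma_finite_measure M" and u: "u \<in> borel_measurable M"
  shows "(\<forall>F \<in> dom (op_power (L2 M) (mult_op M u) n). Theta (L2 M) (mult_op M u) n F \<le> 0) \<longleftrightarrow>
    (AE x in M. triangle_fun u n x \<le> 0)"
proof
  assume ae: "AE x in M. triangle_fun u n x \<le> 0"
  show "\<forall>F \<in> dom (op_power (L2 M) (mult_op M u) n). Theta (L2 M) (mult_op M u) n F \<le> 0"
  proof
    fix F assume "F \<in> dom (op_power (L2 M) (mult_op M u) n)"
    with u obtain f where "f \<in> sq_integrable M" "F = ae_rel M `` {f}"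
      "\<And>i. i \<le> n \<Longrightarrow> (\<lambda>x. u x ^ i * f x) \<in> sq_integrable M"
      by (rule dom_op_power_mult_opE) blast
    moreover have "AE x in M. triangle_fun u n x * (cmod (f x))\<^sup>2 \<le> 0"
      using ae by eventually_elim (simp add: mult_nonpos_nonneg)
    \<comment> \<open>The negated integrand is nonnegative almost everywhere, hence so is its
      integral.\<close>
    ultimately show "Theta (L2 M) (mult_op M u) n F \<le> 0"
      using Theta_mult_op[OF u, of n f]
        Bochner_Integration.integral_nonneg_AE[of "\<lambda>x. - (triangle_fun u n x * (cmod (f x))\<^sup>2)" M]
      by simp
  qed
next
  assume Theta: "\<forall>F \<in> dom (op_power (L2 M) (mult_op M u) n). Theta (L2 M) (mult_op M u) n F \<le> 0"
  interpret sigma_finite_measure M by fact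
  note [measurable] = u
  obtain A :: "nat \<Rightarrow> 'a set" where A: "range A \<subseteq> sets M" "(\<Union>i. A i) = space M"
    "\<And>i. emeasure M (A i) \<noteq> \<infinity>"
    using sigma_finite by blast
  then have [measurable]: "\<And>j. A j \<in> sets M" by auto
  \<comment> \<open>\<open>A j\<close> gives finite measure, and the bound \<open>m\<close> puts the
    indicator into the domain of the \<open>n\<close>-th power.\<close>
  define B where "B j m = {x \<in> space M. x \<in> A j \<and> cmod (u x) \<le> real m \<and> triangle_fun u n x > 0}"
    for j m :: nat
  have [measurable]: "B j m \<in> sets M" for j m unfolding B_def by measurable
  have null: "AE x in M. x \<notin> B j m" for j m
  proof -
    let ?f = "indicator (B j m) :: 'a \<Rightarrow> complex"
    have "emeasure M (B j m) \<le> emeasure M (A j)"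
      by (intro emeasure_mono) (auto simp: B_def)
    then have "emeasure M (B j m) < \<infinity>"
      using A(3)[of j] by (simp add: less_top le_less_trans)
    then have sq: "(\<lambda>x. u x ^ i * ?f x) \<in> sq_integrable M" for i
      by (intro power_mult_indicator_sq_integrable[where C = m]) (auto simp: B_def)
    have f: "?f \<in> sq_integrable M" using sq[of 0] by simp
    have "ae_rel M `` {?f} \<in> dom (op_power (L2 M) (mult_op M u) n)"
      using sq by (simp add: op_power_mult_op[OF u f] dom_def)
    from bspec[OF Theta this] have le: "(\<integral>x. triangle_fun u n x * (cmod (?f x))\<^sup>2 \<partial>M) \<le> 0"
      by (simp only: Theta_mult_op(2)[OF u sq])
    \<comment> \<open>The integrand is strictly positive on \<open>B j m\<close> and zero elsewhere.
      With \<open>le\<close> its integral vanishes, which forces \<open>B j m\<close> to be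
      null.\<close>
    have nonneg: "0 \<le> triangle_fun u n x * (cmod (?f x))\<^sup>2" for x
      by (auto simp: B_def indicator_def)
    have "(\<integral>x. triangle_fun u n x * (cmod (?f x))\<^sup>2 \<partial>M) = 0"
      by (rule antisym[OF le Bochner_Integration.integral_nonneg[OF nonneg]])
    then have "AE x in M. triangle_fun u n x * (cmod (?f x))\<^sup>2 = 0"
      using integral_nonneg_eq_0_iff_AE[OF Theta_mult_op(1)[OF u sq, of n] AE_I2[OF nonneg]]
      by (rule iffD1[rotated])
    then show ?thesis by eventually_elim (auto simp: B_def indicator_def)
  qed
  then have "AE x in M. \<forall>j m. x \<notin> B j m" unfolding AE_all_countable by blast
  then show "AE x in M. triangle_fun u n x \<le> 0"
    using AE_space
  proof eventually_elim
    case (elim x)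
    \<comment> \<open>With \<open>j\<close> and \<open>m\<close> chosen to suit \<open>x\<close>,
      only the sign condition can keep \<open>x\<close> out of \<open>B j m\<close>.\<close>
    obtain j where "x \<in> A j" using A(2) elim(2) by blast
    moreover obtain m where "cmod (u x) \<le> real m" using real_arch_simple by blast
    moreover have "x \<notin> B j m" using elim(1) by simp
    ultimately show ?case using elim(2) by (simp add: B_def not_less)
  qed
qed

lemma completely_alternating_cmod_power_iff:
  "completely_alternating (\<lambda>i. (cmod (u x)) ^ (2 * i)) \<longleftrightarrow> (\<forall>n\<ge>1. triangle_fun u n x \<le> 0)"
proof -
  have "(\<Sum>i\<le>n. (-1) ^ i * real (n choose i) * (cmod (u x)) ^ (2 * (m + i))) =
      (cmod (u x)) ^ (2 * m) * triangle_fun u n x" for m n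
    by (simp add: triangle_fun_def sum_distrib_left distrib_left power_add mult_ac)
  then have "completely_alternating (\<lambda>i. (cmod (u x)) ^ (2 * i)) \<longleftrightarrow>
      (\<forall>m. \<forall>n\<ge>1. (cmod (u x)) ^ (2 * m) * triangle_fun u n x \<le> 0)"
    by (simp add: completely_alternating_def)
  also have "\<dots> \<longleftrightarrow> (\<forall>n\<ge>1. triangle_fun u n x \<le> 0)"
  proof
    assume "\<forall>m. \<forall>n\<ge>1. (cmod (u x)) ^ (2 * m) * triangle_fun u n x \<le> 0"
    \<comment> \<open>At \<open>m = 0\<close> the factor is 1, even where
      \<open>u x = 0\<close>.\<close>
    from spec[OF this, of 0] show "\<forall>n\<ge>1. triangle_fun u n x \<le> 0" by simp
  qed (auto intro: mult_nonneg_nonpos)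
  finally show ?thesis .
qed

theorem corollary2p14:
  fixes M :: "'a measure" and u :: "'a \<Rightarrow> complex" and k :: nat
  assumes "sigma_finite_measure M"
    and "u \<in> borel_measurable M"
    and "dense_in (L2 M) (dom (op_power (L2 M) (mult_op M u) 2))"
    and "k \<ge> 1"
  shows "(k_hyperexpansive (L2 M) k (mult_op M u) \<longleftrightarrow>
            (\<forall>i \<in> {1..k}. AE x in M. triangle_fun u i x \<le> 0))
       \<and> (completely_hyperexpansive (L2 M) (mult_op M u) \<longleftrightarrow>
            (AE x in M. completely_alternating (\<lambda>i. (cmod (u x)) ^ (2 * i))))"
  unfolding k_hyperexpansive_def completely_hyperexpansive_def
    Theta_mult_op_nonpos_iff[OF assms(1,2)] completely_alternating_cmod_power_iff
  \<comment> \<open>The first equivalence has become trivial; in the second, the countable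
    quantifier over \<open>n\<close> commutes with \<open>AE\<close>.\<close>
  by (simp add: AE_all_countable)

end
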